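(* Let $o_1,o_2>0$. For any prior (probability) distribution $\pi$ over $(0,1)$, the $\pi$-mixture wealth $W_t^\pi(\tilde c^t;o_1,o_2)$ of the continuous two-horse race is achievable, and for every $t\ge 0$ and $\tilde c^t\in[0,1]^t$ it can be written as $$W_t^\pi(\tilde c^t;o_1,o_2)=W_0\sum_{k=0}^to_1^ko_2^{t-k}\,\psi_t^\pi(k)\,\tilde c^t(k),$$ where $$\psi_t^\pi(k)=\int_0^1b^k(1-b)^{t-k}\,d\pi(b),\qquad \tilde c^t(k)=\sum_{z^t\in\{0,1\}^t:\ k(z^t)=k}\ \prod_{i=1}^t\tilde c_i^{\,z_i}(1-\tilde c_i)^{1-z_i},$$ and $k(z^t)=\sum_{i=1}^tz_i$. Furthermore, for each $t\ge1$, $$\tilde c^t(k)=\begin{cases}(1-\tilde c_t)\,\tilde c^{t-1}(0)&\text{if }k=0,\\ \tilde c_t\,\tilde c^{t-1}(k-1)+(1-\tilde c_t)\,\tilde c^{t-1}(k)&\text{if }1\le k\le t-1,\\ \tilde c_t\,\tilde c^{t-1}(t-1)&\text{if }k=t.\end{cases}$$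
   Context: In the continuous two-horse race with odds $o_1,o_2>0$, the outcome at time $t$ is $\tilde c_t\in[0,1]$ with odds vector $[o_1\tilde c_t,o_2(1-\tilde c_t)]$. A causal betting strategy is a sequence of functions $b_t=b_t(\tilde c^{t-1})\in[0,1]$, with wealth $W_0\prod_{i=1}^t(o_1\tilde c_ib_i+o_2(1-\tilde c_i)(1-b_i))$, $W_0>0$. The constant bettor $b\in[0,1]$ has wealth $W_t^b(\tilde c^t;o_1,o_2)=W_0\prod_{i=1}^t(o_1\tilde c_ib+o_2(1-\tilde c_i)(1-b))$, and the $\pi$-mixture wealth is $W_t^\pi(\tilde c^t;o_1,o_2)=\int W_t^b(\tilde c^t;o_1,o_2)\,d\pi(b)$. A sequence of functions $(\Phi_t(\tilde c^t))_{t\ge0}$ is achievable if there is a causal betting strategy whose wealth is at least $\Phi_t(\tilde c^t)$ for all $t$ and all $\tilde c^t\in[0,1]^t$. Conventions: $0^0=1$ and, for the empty sequence, $\tilde c^0(0)=1$. *)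

theory Defs
  imports "HOL-Probability.Probability"
begin

text \<open>
  A finite sequence with entries at times 1 to \<open>t\<close> is a list of length \<open>t\<close>. List positions
  start at 0, so \<open>c ! i\<close> is the outcome at time \<open>i + 1\<close>, and \<open>take i c\<close> consists of the
  outcomes known before it.
\<close>

definition outcome_seqs :: "nat \<Rightarrow> real list set" where
  "outcome_seqs t = {c. length c = t \<and> set c \<subseteq> {0..1}}"

text \<open>
  \<open>b t\<close> is the bet placed at time \<open>t \<ge> 1\<close>, given the \<open>t - 1\<close> previous outcomes;
  \<open>b 0\<close> is never used.
\<close>

definition causal_strategy :: "(nat \<Rightarrow> real list \<Rightarrow> real) \<Rightarrow> bool" where
  "causal_strategy b \<longleftrightarrow> (\<forall>t. \<forall>c \<in> outcome_seqs t. b (Suc t) c \<in> {0..1})"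

definition wealth ::
  "real \<Rightarrow> real \<Rightarrow> real \<Rightarrow> (nat \<Rightarrow> real list \<Rightarrow> real) \<Rightarrow> nat \<Rightarrow> real list \<Rightarrow> real" where
  "wealth W0 o1 o2 b t c =
     W0 * (\<Prod>i<t. o1 * (c ! i) * b (Suc i) (take i c)
                  + o2 * (1 - c ! i) * (1 - b (Suc i) (take i c)))"

definition const_wealth ::
  "real \<Rightarrow> real \<Rightarrow> real \<Rightarrow> real \<Rightarrow> nat \<Rightarrow> real list \<Rightarrow> real" where
  "const_wealth W0 o1 o2 b t c =
     W0 * (\<Prod>i<t. o1 * (c ! i) * b + o2 * (1 - c ! i) * (1 - b))"

definition mixture_wealth ::
  "real \<Rightarrow> real \<Rightarrow> real \<Rightarrow> real measure \<Rightarrow> nat \<Rightarrow> real list \<Rightarrow> real" where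
  "mixture_wealth W0 o1 o2 \<pi> t c = (\<integral>b. const_wealth W0 o1 o2 b t c \<partial>\<pi>)"

definition achievable ::
  "real \<Rightarrow> real \<Rightarrow> real \<Rightarrow> (nat \<Rightarrow> real list \<Rightarrow> real) \<Rightarrow> bool" where
  "achievable W0 o1 o2 \<Phi> \<longleftrightarrow>
     (\<exists>b. causal_strategy b \<and>
          (\<forall>t. \<forall>c \<in> outcome_seqs t. wealth W0 o1 o2 b t c \<ge> \<Phi> t c))"

definition mixture_coeff :: "real measure \<Rightarrow> nat \<Rightarrow> nat \<Rightarrow> real" where
  "mixture_coeff \<pi> t k = (\<integral>b. b ^ k * (1 - b) ^ (t - k) \<partial>\<pi>)"

definition binary_seqs :: "nat \<Rightarrow> nat list set" where
  "binary_seqs t = {z. length z = t \<and> set z \<subseteq> {0, 1}}"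

definition type_weight :: "nat \<Rightarrow> real list \<Rightarrow> nat \<Rightarrow> real" where
  "type_weight t c k =
     (\<Sum>z \<in> {z \<in> binary_seqs t. sum_list z = k}.
        \<Prod>i<t. (c ! i) ^ (z ! i) * (1 - c ! i) ^ (1 - z ! i))"

end

theory Submission
  imports Defs
begin

text \<open>
  Betting at each time the posterior mean of \<open>b\<close>, the prior reweighted by the wealth of the constant
  bettors so far, makes the wealth equal to the mixture wealth: the next factor of a constant bettor is
  affine in \<open>b\<close>, so averaging it against the posterior amounts to evaluating it at the mean. The
  coefficient formula is the expansion of a product of \<open>t\<close> binomials, by induction on \<open>t\<close> via the
  Pascal-type recursion for the weights.
\<close>

section \<open>Weights of outcome sequences by number of ones, and the product expansion\<close>

lemma finite_binary_seqs: "finite (binary_seqs t)"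
  using finite_lists_length_eq[of "{0, 1::nat}" t]
  by (simp add: binary_seqs_def conj_commute)

lemma sum_list_binary_seqs_le:
  assumes "z \<in> binary_seqs t"
  shows "sum_list z \<le> t"
proof -
  have "sum_list z \<le> length z" if "set z \<subseteq> {0, 1::nat}" for z
    using that by (induction z) auto
  from this[of z] show ?thesis
    using assms by (simp add: binary_seqs_def)
qed

lemma binary_seqs_Suc:
  "binary_seqs (Suc t) = (\<lambda>z. z @ [0]) ` binary_seqs t \<union> (\<lambda>z. z @ [1]) ` binary_seqs t"
proof (intro equalityI subsetI)
  fix z assume z: "z \<in> binary_seqs (Suc t)"
  then obtain y a where "z = y @ [a]"
    by (cases z rule: rev_cases) (auto simp: binary_seqs_def)
  with z show "z \<in> (\<lambda>z. z @ [0]) ` binary_seqs t \<union> (\<lambda>z. z @ [1]) ` binary_seqs t"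
    by (auto simp: binary_seqs_def)
qed (auto simp: binary_seqs_def)

text \<open>No binary sequence of length \<open>t\<close> has more than \<open>t\<close> ones. This
  lets one recursion serve the top index as well, its surplus term being 0.\<close>

lemma type_weight_eq_0:
  assumes "t < k"
  shows "type_weight t c k = 0"
proof -
  have "{z \<in> binary_seqs t. sum_list z = k} = {}"
    using sum_list_binary_seqs_le assms by fastforce
  then show ?thesis
    by (simp only: type_weight_def sum.empty)
qed

lemma type_weight_take:
  assumes "t \<le> n"
  shows "type_weight t (take n c) k = type_weight t c k"
  unfolding type_weight_def using assms by (intro sum.cong prod.cong refl) simp

lemma type_weight_0: "type_weight 0 c k = (if k = 0 then 1 else 0)"
proof -
  have "{z \<in> binary_seqs 0. sum_list z = k} = (if k = 0 then {[]} else {})"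
    by (auto simp: binary_seqs_def)
  then show ?thesis
    by (simp add: type_weight_def)
qed

text \<open>Split by the last bit: a final 0 contributes \<open>1 - c ! t\<close> and keeps the
  number of ones, a final 1 contributes \<open>c ! t\<close> and accounts for one of them. The test
  \<open>k = 0\<close> guards against the truncated \<open>k - 1\<close>.\<close>

lemma type_weight_Suc:
  "type_weight (Suc t) c k =
     (1 - c ! t) * type_weight t c k + (if k = 0 then 0 else c ! t * type_weight t c (k - 1))"
proof -
  define f where "f t z = (\<Prod>i<t. (c ! i) ^ (z ! i) * (1 - c ! i) ^ (1 - z ! i))" for t and z :: "nat list"
  let ?S0 = "{z \<in> binary_seqs t. sum_list z = k}"
  let ?S1 = "{z \<in> binary_seqs t. Suc (sum_list z) = k}"
  have tw: "type_weight t c k = sum (f t) {z \<in> binary_seqs t. sum_list z = k}" for t k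
    by (simp add: type_weight_def f_def)
  have f_snoc: "f (Suc t) (z @ [a]) = f t z * ((c ! t) ^ a * (1 - c ! t) ^ (1 - a))"
    if "z \<in> binary_seqs t" for z a
  proof -
    have "length z = t"
      using that by (simp add: binary_seqs_def)
    then show ?thesis
      by (simp add: f_def nth_append)
  qed
  have "{z \<in> binary_seqs (Suc t). sum_list z = k} = (\<lambda>z. z @ [0]) ` ?S0 \<union> (\<lambda>z. z @ [1]) ` ?S1"
    unfolding binary_seqs_Suc by auto
  then have "type_weight (Suc t) c k =
      sum (f (Suc t)) ((\<lambda>z. z @ [0]) ` ?S0 \<union> (\<lambda>z. z @ [1]) ` ?S1)"
    by (simp only: tw)
  also have "\<dots> = sum (f (Suc t)) ((\<lambda>z. z @ [0]) ` ?S0) + sum (f (Suc t)) ((\<lambda>z. z @ [1]) ` ?S1)"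
    by (intro sum.union_disjoint finite_imageI) (auto simp: finite_binary_seqs)
  also have "sum (f (Suc t)) ((\<lambda>z. z @ [0]) ` ?S0) = (1 - c ! t) * type_weight t c k"
    by (subst sum.reindex) (auto simp: inj_on_def f_snoc tw sum_distrib_left mult.commute)
  also have "sum (f (Suc t)) ((\<lambda>z. z @ [1]) ` ?S1) = c ! t * sum (f t) ?S1"
    by (subst sum.reindex) (auto simp: inj_on_def f_snoc sum_distrib_left mult.commute)
  \<comment> \<open>For \<open>k = 0\<close> the set \<open>?S1\<close> is empty, since it is cut
    out by a successor rather than by \<open>k - 1\<close>.\<close>
  also have "c ! t * sum (f t) ?S1 = (if k = 0 then 0 else c ! t * type_weight t c (k - 1))"
    by (cases k) (simp_all add: tw)
  finally show ?thesis .
qed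

lemma prod_eq_sum_type_weight:
  "(\<Prod>i<t. A * c ! i + B * (1 - c ! i)) = (\<Sum>k\<le>t. A ^ k * B ^ (t - k) * type_weight t c k)"
proof (induction t)
  case 0
  then show ?case
    by (simp add: type_weight_0)
next
  case (Suc t)
  let ?g = "\<lambda>k. A ^ k * B ^ (t - k) * type_weight t c k"
  have "(\<Sum>k\<le>Suc t. A ^ k * B ^ (Suc t - k) * type_weight (Suc t) c k) =
      (\<Sum>k\<le>Suc t. A ^ k * B ^ (Suc t - k) * ((1 - c ! t) * type_weight t c k)) +
      (\<Sum>k\<le>Suc t. A ^ k * B ^ (Suc t - k) *
         (if k = 0 then 0 else c ! t * type_weight t c (k - 1)))"
    by (simp only: type_weight_Suc distrib_left sum.distrib)
  \<comment> \<open>The top term \<open>k = Suc t\<close> vanishes; in all others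
    \<open>Suc t - k\<close> is \<open>Suc (t - k)\<close>, which frees one factor
    \<open>B\<close>.\<close>
  also have "(\<Sum>k\<le>Suc t. A ^ k * B ^ (Suc t - k) * ((1 - c ! t) * type_weight t c k)) =
      (\<Sum>k\<le>t. B * (1 - c ! t) * ?g k)"
    by (simp add: type_weight_eq_0 Suc_diff_le mult_ac)
  also have "(\<Sum>k\<le>Suc t. A ^ k * B ^ (Suc t - k) *
         (if k = 0 then 0 else c ! t * type_weight t c (k - 1))) = (\<Sum>k\<le>t. A * c ! t * ?g k)"
    \<comment> \<open>The term \<open>k = 0\<close> is 0, and shifting the index down by one frees
      one factor \<open>A\<close>.\<close>
    unfolding sum.atMost_Suc_shift by (simp add: mult_ac)
  finally have "(\<Sum>k\<le>Suc t. A ^ k * B ^ (Suc t - k) * type_weight (Suc t) c k) =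
      B * (1 - c ! t) * (\<Sum>k\<le>t. ?g k) + A * c ! t * (\<Sum>k\<le>t. ?g k)"
    by (simp only: sum_distrib_left)
  then show ?case
    by (simp only: prod.lessThan_Suc Suc.IH) (simp only: algebra_simps)
qed

section \<open>Wealth of the constant bettors\<close>

lemma const_wealth_eq_sum:
  "const_wealth W0 o1 o2 b t c =
     W0 * (\<Sum>k\<le>t. o1 ^ k * o2 ^ (t - k) * type_weight t c k * (b ^ k * (1 - b) ^ (t - k)))"
  \<comment> \<open>The powers of \<open>b\<close> and \<open>1 - b\<close> are split off from the
    odds, so that integrating them over the prior yields \<open>mixture_coeff\<close>.\<close>
  using prod_eq_sum_type_weight[of "o1 * b" c "o2 * (1 - b)" t]
  by (simp add: const_wealth_def power_mult_distrib mult_ac)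

lemma const_wealth_take:
  assumes "t \<le> n"
  shows "const_wealth W0 o1 o2 b t (take n c) = const_wealth W0 o1 o2 b t c"
  unfolding const_wealth_def using assms by simp

lemma const_wealth_nonneg:
  assumes "W0 \<ge> 0" "o1 \<ge> 0" "o2 \<ge> 0" "b \<in> {0..1}" "t \<le> length c" "set c \<subseteq> {0..1}"
  shows "const_wealth W0 o1 o2 b t c \<ge> 0"
proof -
  have "c ! i \<in> {0..1}" if "i < t" for i
    using that assms(5) by (intro subsetD[OF assms(6)] nth_mem) simp
  then show ?thesis
    using assms unfolding const_wealth_def
    by (intro mult_nonneg_nonneg prod_nonneg add_nonneg_nonneg ballI) auto
qed

lemma continuous_on_const_wealth [continuous_intros]:
  "continuous_on S (\<lambda>b. const_wealth W0 o1 o2 b t c)"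
  unfolding const_wealth_def by (intro continuous_intros)

section \<open>Integration against the prior\<close>

locale prior = prob_space \<pi> for \<pi> :: "real measure" +
  assumes sets_prior: "sets \<pi> = sets (restrict_space borel {0<..<1})"
begin

lemma space_prior: "space \<pi> = {0<..<1}"
  using sets_eq_imp_space_eq[OF sets_prior] by (simp add: space_restrict_space)

text \<open>Continuity on the whole line gives a bound on the compact interval [0,1], which contains
  the space (0,1); continuity on (0,1) alone would allow blow-up at the ends.\<close>

lemma integrable_continuous:
  fixes f :: "real \<Rightarrow> real"
  assumes "continuous_on UNIV f"
  shows "integrable \<pi> f"
proof -
  have "compact (f ` {0..1})"
    using assms by (intro compact_continuous_image) (auto intro: continuous_on_subset)
  then obtain B where "\<forall>x\<in>{0..1}. norm (f x) \<le> B"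
    by (auto dest!: compact_imp_bounded simp: bounded_iff)
  then have "AE x in \<pi>. norm (f x) \<le> B"
    by (intro AE_I2) (simp add: space_prior)
  moreover have "f \<in> borel_measurable (restrict_space borel {0<..<1})"
    using assms by (intro measurable_restrict_space1 borel_measurable_continuous_onI)
  then have "f \<in> borel_measurable \<pi>"
    using measurable_cong_sets[OF sets_prior refl] by blast
  ultimately show ?thesis
    by (rule integrable_const_bound)
qed

lemma mixture_wealth_eq_sum:
  "mixture_wealth W0 o1 o2 \<pi> t c =
     W0 * (\<Sum>k=0..t. o1 ^ k * o2 ^ (t - k) * mixture_coeff \<pi> t k * type_weight t c k)"
proof -
  have "integrable \<pi> (\<lambda>b. b ^ k * (1 - b) ^ (t - k))" for k
    by (intro integrable_continuous continuous_intros)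
  then show ?thesis
    unfolding mixture_wealth_def const_wealth_eq_sum mixture_coeff_def
    by (simp add: atLeast0AtMost) (simp add: mult_ac)
qed

section \<open>The posterior mean as a betting strategy\<close>

definition posterior_mean :: "real \<Rightarrow> real \<Rightarrow> real \<Rightarrow> nat \<Rightarrow> real list \<Rightarrow> real" where
  "posterior_mean W0 o1 o2 t c =
     (\<integral>b. b * const_wealth W0 o1 o2 b t c \<partial>\<pi>) / mixture_wealth W0 o1 o2 \<pi> t c"

context
  fixes W0 o1 o2 :: real
  assumes nonneg: "W0 \<ge> 0" "o1 \<ge> 0" "o2 \<ge> 0"
begin

text \<open>On the support 0 < \<open>b\<close> < 1 and the constant wealth is nonnegative, so
  \<open>b * const_wealth\<close> lies pointwise between 0 and \<open>const_wealth\<close>.\<close>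

lemma posterior_moment_bounds:
  assumes "t \<le> length c" "set c \<subseteq> {0..1}"
  shows "0 \<le> (\<integral>b. b * const_wealth W0 o1 o2 b t c \<partial>\<pi>)"
    and "(\<integral>b. b * const_wealth W0 o1 o2 b t c \<partial>\<pi>) \<le> mixture_wealth W0 o1 o2 \<pi> t c"
proof -
  have nn: "const_wealth W0 o1 o2 b t c \<ge> 0" if "b \<in> space \<pi>" for b
    using that nonneg assms by (intro const_wealth_nonneg) (auto simp: space_prior)
  show "0 \<le> (\<integral>b. b * const_wealth W0 o1 o2 b t c \<partial>\<pi>)"
    using nn by (intro integral_nonneg_AE AE_I2) (simp add: space_prior)
  show "(\<integral>b. b * const_wealth W0 o1 o2 b t c \<partial>\<pi>) \<le> mixture_wealth W0 o1 o2 \<pi> t c"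
    unfolding mixture_wealth_def
    using nn by (intro integral_mono integrable_continuous continuous_intros)
      (auto simp: space_prior intro!: mult_left_le_one_le)
qed

text \<open>If the mixture wealth is 0, the quotient is 0 by convention, still a legal bet.\<close>

lemma posterior_mean_in_unit:
  assumes "t \<le> length c" "set c \<subseteq> {0..1}"
  shows "posterior_mean W0 o1 o2 t c \<in> {0..1}"
  using posterior_moment_bounds[OF assms] by (auto simp: posterior_mean_def divide_le_eq_1)

text \<open>
  When the mixture wealth vanishes, so does the first moment, so the junk value of the quotient is harmless.
\<close>

lemma posterior_mean_mult_mixture_wealth:
  assumes "t \<le> length c" "set c \<subseteq> {0..1}"
  shows "mixture_wealth W0 o1 o2 \<pi> t c * posterior_mean W0 o1 o2 t c =
     (\<integral>b. b * const_wealth W0 o1 o2 b t c \<partial>\<pi>)"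
  using posterior_moment_bounds[OF assms] by (auto simp: posterior_mean_def)

lemma mixture_wealth_Suc:
  assumes "t \<le> length c" "set c \<subseteq> {0..1}"
  shows "mixture_wealth W0 o1 o2 \<pi> (Suc t) c =
     mixture_wealth W0 o1 o2 \<pi> t c *
       (o1 * c ! t * posterior_mean W0 o1 o2 t c +
        o2 * (1 - c ! t) * (1 - posterior_mean W0 o1 o2 t c))"
proof -
  let ?W = "\<lambda>b. const_wealth W0 o1 o2 b t c"
  have int: "integrable \<pi> ?W" "integrable \<pi> (\<lambda>b. b * ?W b)"
    by (intro integrable_continuous continuous_intros)+
  have "mixture_wealth W0 o1 o2 \<pi> (Suc t) c =
      (\<integral>b. o1 * c ! t * (b * ?W b) + o2 * (1 - c ! t) * (?W b - b * ?W b) \<partial>\<pi>)"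
    unfolding mixture_wealth_def
    by (intro Bochner_Integration.integral_cong) (simp_all add: const_wealth_def algebra_simps)
  also have "\<dots> = o1 * c ! t * (\<integral>b. b * ?W b \<partial>\<pi>) +
      o2 * (1 - c ! t) * (mixture_wealth W0 o1 o2 \<pi> t c - (\<integral>b. b * ?W b \<partial>\<pi>))"
    using int by (simp add: mixture_wealth_def)
  also have "\<dots> = mixture_wealth W0 o1 o2 \<pi> t c *
       (o1 * c ! t * posterior_mean W0 o1 o2 t c +
        o2 * (1 - c ! t) * (1 - posterior_mean W0 o1 o2 t c))"
    unfolding posterior_mean_mult_mixture_wealth[OF assms, symmetric]
    by (simp add: algebra_simps)
  finally show ?thesis .
qed

text \<open>Both wealths start at \<open>W0\<close> and grow by the same factor. The index
  \<open>n - 1\<close> appears because the bet at time \<open>n\<close> has seen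
  \<open>n - 1\<close> outcomes.\<close>

lemma wealth_posterior_mean:
  assumes "t \<le> length c" "set c \<subseteq> {0..1}"
  shows "wealth W0 o1 o2 (\<lambda>n. posterior_mean W0 o1 o2 (n - 1)) t c = mixture_wealth W0 o1 o2 \<pi> t c"
  using assms(1)
proof (induction t)
  case 0
  then show ?case
    by (simp add: wealth_def mixture_wealth_def const_wealth_def prob_space)
next
  case (Suc t)
  have "posterior_mean W0 o1 o2 t (take t c) = posterior_mean W0 o1 o2 t c"
    by (simp add: posterior_mean_def mixture_wealth_def const_wealth_take)
  then have "wealth W0 o1 o2 (\<lambda>n. posterior_mean W0 o1 o2 (n - 1)) (Suc t) c =
      wealth W0 o1 o2 (\<lambda>n. posterior_mean W0 o1 o2 (n - 1)) t c *
        (o1 * c ! t * posterior_mean W0 o1 o2 t c +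
         o2 * (1 - c ! t) * (1 - posterior_mean W0 o1 o2 t c))"
    by (simp add: wealth_def)
  then show ?case
    using Suc assms(2) by (simp add: mixture_wealth_Suc)
qed

lemma achievable_mixture_wealth: "achievable W0 o1 o2 (mixture_wealth W0 o1 o2 \<pi>)"
  unfolding achievable_def
proof (intro exI conjI allI ballI)
  show "causal_strategy (\<lambda>n. posterior_mean W0 o1 o2 (n - 1))"
    unfolding causal_strategy_def outcome_seqs_def
    by (auto simp del: atLeastAtMost_iff intro!: posterior_mean_in_unit)
qed (use wealth_posterior_mean in \<open>auto simp: outcome_seqs_def\<close>)

end

end

theorem theorem12:
  fixes W0 o1 o2 :: real and \<pi> :: "real measure"
  assumes "W0 > 0" and "o1 > 0" and "o2 > 0"
    and "prob_space \<pi>" and "sets \<pi> = sets (restrict_space borel {0<..<1})"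
  shows "achievable W0 o1 o2 (mixture_wealth W0 o1 o2 \<pi>)
    \<and> (\<forall>t. \<forall>c \<in> outcome_seqs t.
         mixture_wealth W0 o1 o2 \<pi> t c =
           W0 * (\<Sum>k=0..t. o1 ^ k * o2 ^ (t - k) * mixture_coeff \<pi> t k * type_weight t c k))
    \<and> (\<forall>t\<ge>1. \<forall>c \<in> outcome_seqs t. \<forall>k \<le> t.
         type_weight t c k =
           (if k = 0 then (1 - c ! (t - 1)) * type_weight (t - 1) (take (t - 1) c) 0
            else if k \<le> t - 1 then
              c ! (t - 1) * type_weight (t - 1) (take (t - 1) c) (k - 1)
              + (1 - c ! (t - 1)) * type_weight (t - 1) (take (t - 1) c) k
            else c ! (t - 1) * type_weight (t - 1) (take (t - 1) c) (t - 1)))"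
proof (intro conjI allI ballI impI)
  interpret prior \<pi>
    using assms by (simp add: prior_def prior_axioms_def)
  show "achievable W0 o1 o2 (mixture_wealth W0 o1 o2 \<pi>)"
    using assms by (intro achievable_mixture_wealth) simp_all
  show "mixture_wealth W0 o1 o2 \<pi> t c =
      W0 * (\<Sum>k=0..t. o1 ^ k * o2 ^ (t - k) * mixture_coeff \<pi> t k * type_weight t c k)" for t c
    by (rule mixture_wealth_eq_sum)
next
  fix t k :: nat and c :: "real list"
  assume "1 \<le> t" "k \<le> t"
  moreover from \<open>1 \<le> t\<close> obtain s where "t = Suc s"
    by (cases t) auto
  ultimately show "type_weight t c k =
      (if k = 0 then (1 - c ! (t - 1)) * type_weight (t - 1) (take (t - 1) c) 0
       else if k \<le> t - 1 then
         c ! (t - 1) * type_weight (t - 1) (take (t - 1) c) (k - 1)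
         + (1 - c ! (t - 1)) * type_weight (t - 1) (take (t - 1) c) k
       else c ! (t - 1) * type_weight (t - 1) (take (t - 1) c) (t - 1))"
    \<comment> \<open>For \<open>k = Suc s\<close> the term with the factor \<open>1 - c ! s\<close>
      carries a weight beyond the top index and drops out.\<close>
    by (auto simp: type_weight_Suc type_weight_take type_weight_eq_0 le_Suc_eq)
qed

end
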